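(* Consider a core-producing algorithm for a family of downwards-closed games (an algorithm which, given a game of the family, outputs an element of its core). Consider an instance (a game in the family, with player set $N$ and payoff sets $\Pi(S)$, $S\subseteq N$) for which $LP_{fair}\ge\tau$. For any $\lambda\in(0,1)$ we can compute a $\frac{1}{1-\lambda}$-approximate core vector $\pi$ of this instance with fairness at least $\lambda\tau$, i.e. $\min_{v\in N}\pi_v\ge\lambda\tau$.
   Context: **Coalition game (non-transferable utility).** A finite set $N$ of players and a map $\Pi$ assigning to each $S\subseteq N$ a set $\Pi(S)\subseteq\mathbb R^N$ of payoff vectors available to $S$, with $\pi_i=0$ for all $\pi\in\Pi(S)$ and $i\notin S$. **Downwards-closed game.** For each $S$, $\Pi(S)$ is a downwards-closed polytope in $\mathbb R^N_{\ge 0}$ (if $\pi\in\Pi(S)$ and $0\le\pi'\le\pi$ coordinatewise then $\pi'\in\Pi(S)$). **Core and approximate core.** For $\alpha\ge 1$, a vector $\pi\in\Pi(N)$ is an $\alpha$-approximate core vector (is in the $\alpha$-core) if there is no nonempty proper subset $S\subsetneq N$ and $\pi'\in\Pi(S)$ with $\pi'_i>\alpha\pi_i$ for all $i\in S$. The core is the $1$-core. **Fairness.** The fairness of a payoff vector $\pi$ is $\min_{v\in N}\pi_v$, and $LP_{fair}=\max_{\pi\in\Pi(N)}\min_{v\in N}\pi_v$ (a linear program, since $\Pi(N)$ is a polytope). Here $\tau\ge 0$. *)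

theory Defs
  imports "HOL-Analysis.Analysis" "HOL-Library.Function_Algebras"
begin

subsection \<open>Payoff vectors\<close>

text \<open>
  A vector in \<open>\<real>\<^sup>N\<close> is a function on the type of all potential players that vanishes outside
  the finite set \<open>N\<close>.  The pointwise vector space structure on functions makes the library
  notions \<^const>\<open>polytope\<close> and \<^const>\<open>convex\<close> applicable to sets of payoff vectors.
\<close>

instantiation "fun" :: (type, real_vector) real_vector
begin

definition scaleR_fun :: "real \<Rightarrow> ('a \<Rightarrow> 'b) \<Rightarrow> 'a \<Rightarrow> 'b" where
  "scaleR_fun r f = (\<lambda>x. r *\<^sub>R f x)"

instance
  by standard (simp_all add: scaleR_fun_def fun_eq_iff scaleR_add_right scaleR_add_left)

end

subsection \<open>Coalition games\<close>

record 'a game =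
  players :: "'a set"
  payoffs :: "'a set \<Rightarrow> ('a \<Rightarrow> real) set"

text \<open>
  The player set is nonempty because the fairness is a minimum over all players.  The values of
  \<^const>\<open>payoffs\<close> on sets that are not coalitions are irrelevant.
\<close>

definition downwards_closed_game :: "'a game \<Rightarrow> bool" where
  "downwards_closed_game G \<longleftrightarrow>
     finite (players G) \<and> players G \<noteq> {} \<and>
     (\<forall>S \<subseteq> players G.
        polytope (payoffs G S) \<and>
        (\<forall>\<pi> \<in> payoffs G S. (\<forall>i. 0 \<le> \<pi> i) \<and> (\<forall>i. i \<notin> S \<longrightarrow> \<pi> i = 0)) \<and>
        (\<forall>\<pi> \<in> payoffs G S. \<forall>\<pi>'. (\<forall>i. 0 \<le> \<pi>' i \<and> \<pi>' i \<le> \<pi> i) \<longrightarrow> \<pi>' \<in> payoffs G S))"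

definition approx_core :: "real \<Rightarrow> 'a game \<Rightarrow> ('a \<Rightarrow> real) set" where
  "approx_core \<alpha> G =
     {\<pi> \<in> payoffs G (players G).
        \<not> (\<exists>S \<pi>'. S \<noteq> {} \<and> S \<subset> players G \<and> \<pi>' \<in> payoffs G S \<and> (\<forall>i\<in>S. \<pi>' i > \<alpha> * \<pi> i))}"

definition core :: "'a game \<Rightarrow> ('a \<Rightarrow> real) set" where
  "core G = approx_core 1 G"

definition fairness :: "'a game \<Rightarrow> ('a \<Rightarrow> real) \<Rightarrow> real" where
  "fairness G \<pi> = Min (\<pi> ` players G)"

text \<open>
  The supremum is a maximum whenever the set of payoff vectors of the grand coalition is a
  nonempty polytope.
\<close>

definition LP_fair :: "'a game \<Rightarrow> real" where
  "LP_fair G = (SUP \<pi> \<in> payoffs G (players G). fairness G \<pi>)"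

subsection \<open>Algorithms\<close>

text \<open>
  Since payoffs are real numbers, algorithms are programs for a real-number machine (with exact
  arithmetic and sign tests, as in the real-RAM and Blum-Shub-Smale models).  The
  memory of the machine is a binary tree with real leaves, which serves to encode tuples and
  lists.  The only real constant is 1, so no information can be hidden in a program constant.
\<close>

datatype data = Null | Num real | Cell data data

datatype prog =
    Ident | Empty | Unit
  | Left | Right
  | Fork prog prog
  | Seq prog prog
  | Add | Sub | Mul | Div
  | IsNum | IsCell
  | Branch prog prog prog
  | Loop prog prog

text \<open>
  \<open>runs p x y\<close>: program \<open>p\<close> on input \<open>x\<close> halts with output \<open>y\<close>.  A program that does not
  terminate, divides by zero or applies an instruction to data of the wrong shape has no output.
  A condition holds if its value is a positive number.
\<close>

inductive runs :: "prog \<Rightarrow> data \<Rightarrow> data \<Rightarrow> bool" where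
  "runs Ident x x"
| "runs Empty x Null"
| "runs Unit x (Num 1)"
| "runs Left (Cell x y) x"
| "runs Right (Cell x y) y"
| "runs p x y \<Longrightarrow> runs q x z \<Longrightarrow> runs (Fork p q) x (Cell y z)"
| "runs p x y \<Longrightarrow> runs q y z \<Longrightarrow> runs (Seq p q) x z"
| "runs Add (Cell (Num a) (Num b)) (Num (a + b))"
| "runs Sub (Cell (Num a) (Num b)) (Num (a - b))"
| "runs Mul (Cell (Num a) (Num b)) (Num (a * b))"
| "b \<noteq> 0 \<Longrightarrow> runs Div (Cell (Num a) (Num b)) (Num (a / b))"
| "runs IsNum x (Num (case x of Num a \<Rightarrow> 1 | _ \<Rightarrow> 0))"
| "runs IsCell x (Num (case x of Cell y z \<Rightarrow> 1 | _ \<Rightarrow> 0))"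
| "runs b x (Num a) \<Longrightarrow> a > 0 \<Longrightarrow> runs p x y \<Longrightarrow> runs (Branch b p q) x y"
| "runs b x (Num a) \<Longrightarrow> a \<le> 0 \<Longrightarrow> runs q x y \<Longrightarrow> runs (Branch b p q) x y"
| "runs b x (Num a) \<Longrightarrow> a > 0 \<Longrightarrow> runs p x y \<Longrightarrow> runs (Loop b p) y z \<Longrightarrow> runs (Loop b p) x z"
| "runs b x (Num a) \<Longrightarrow> a \<le> 0 \<Longrightarrow> runs (Loop b p) x x"

inductive_cases runs_elims:
  "runs Ident x y" "runs Empty x y" "runs Unit x y" "runs Left x y" "runs Right x y"
  "runs Add x y" "runs Sub x y" "runs Mul x y" "runs Div x y"
  "runs IsNum x y" "runs IsCell x y"
inductive_cases runs_ForkE: "runs (Fork p q) x y"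
inductive_cases runs_SeqE: "runs (Seq p q) x y"
inductive_cases runs_BranchE: "runs (Branch b p q) x y"
inductive_cases runs_LoopE: "runs (Loop b p) x y"

text \<open>Programs are deterministic, so the output of a halting program is unique.\<close>

lemma runs_deterministic: "runs p x y \<Longrightarrow> runs p x z \<Longrightarrow> y = z"
proof (induction arbitrary: z rule: runs.induct)
  case (6 p x y q y')
  from \<open>runs (Fork p q) x z\<close> show ?case
    by (rule runs_ForkE) (simp add: 6)
next
  case (7 p x y q y')
  from \<open>runs (Seq p q) x z\<close> obtain u where "runs p x u" "runs q u z"
    by (rule runs_SeqE)
  with 7 show ?case by metis
next
  case (14 b x a p y q)
  have num: "Num a = Num a'" if "runs b x (Num a')" for a'
    using "14.IH"(1) that .
  from \<open>runs (Branch b p q) x z\<close> have "runs p x z"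
    by (rule runs_BranchE) (use num \<open>a > 0\<close> in force)+
  then show ?case by (rule "14.IH")
next
  case (15 b x a q y p)
  have num: "Num a = Num a'" if "runs b x (Num a')" for a'
    using "15.IH"(1) that .
  from \<open>runs (Branch b p q) x z\<close> have "runs q x z"
    by (rule runs_BranchE) (use num \<open>a \<le> 0\<close> in force)+
  then show ?case by (rule "15.IH")
next
  case (16 b x a p y w)
  have num: "Num a = Num a'" if "runs b x (Num a')" for a'
    using "16.IH"(1) that .
  from \<open>runs (Loop b p) x z\<close> obtain u where u: "runs p x u" "runs (Loop b p) u z"
    by (rule runs_LoopE) (use num \<open>a > 0\<close> in force)+
  have "y = u" using u(1) by (rule "16.IH")
  with u(2) have "runs (Loop b p) y z" by simp
  then show ?case by (rule "16.IH")
next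
  case (17 b x a p)
  have num: "Num a = Num a'" if "runs b x (Num a')" for a'
    using "17.IH" that .
  from \<open>runs (Loop b p) x z\<close> show ?case
    by (rule runs_LoopE) (use num \<open>a \<le> 0\<close> in force)+
qed (erule runs_elims, simp)+

subsection \<open>Encodings and families of games\<close>

primrec enc_list :: "data list \<Rightarrow> data" where
  "enc_list [] = Null"
| "enc_list (x # xs) = Cell x (enc_list xs)"

definition enc_vec :: "real list \<Rightarrow> data" where
  "enc_vec xs = enc_list (map Num xs)"

text \<open>
  A payoff vector is encoded by the list of its coordinates, in the order of a fixed enumeration
  \<open>ps\<close> of the players.
\<close>

definition enc_payoff :: "'a list \<Rightarrow> ('a \<Rightarrow> real) \<Rightarrow> data" where
  "enc_payoff ps \<pi> = enc_vec (map \<pi> ps)"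

text \<open>A pair \<open>(a, b)\<close> stands for the linear inequality \<open>a \<bullet> x \<le> b\<close>.\<close>

definition enc_system :: "(real list \<times> real) list \<Rightarrow> data" where
  "enc_system cs = enc_list (map (\<lambda>(a, b). Cell (enc_vec a) (Num b)) cs)"

definition describes :: "'a list \<Rightarrow> (real list \<times> real) list \<Rightarrow> ('a \<Rightarrow> real) set \<Rightarrow> bool" where
  "describes ps cs P \<longleftrightarrow>
     (\<forall>(a, b) \<in> set cs. length a = length ps) \<and>
     P = {\<pi>. (\<forall>i. i \<notin> set ps \<longrightarrow> \<pi> i = 0) \<and>
             (\<forall>(a, b) \<in> set cs. (\<Sum>j<length ps. a ! j * \<pi> (ps ! j)) \<le> b)}"

text \<open>
  The members of a family are given to algorithms as input data: \<open>F\<close> is the set of all legal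
  inputs, \<open>game w\<close> is the game denoted by the input \<open>w\<close>, and \<open>enum w\<close> is the enumeration of its
  players that is used to write down payoff vectors.  The encoding is arbitrary, except that the
  linear inequalities that define the polytope of the grand coalition can be computed from the
  input; this is what makes the fairness problem an (explicitly given) linear program.
\<close>

definition downwards_closed_family ::
    "data set \<Rightarrow> (data \<Rightarrow> 'a game) \<Rightarrow> (data \<Rightarrow> 'a list) \<Rightarrow> bool" where
  "downwards_closed_family F game enum \<longleftrightarrow>
     (\<forall>w\<in>F. downwards_closed_game (game w) \<and>
            distinct (enum w) \<and> set (enum w) = players (game w)) \<and>
     (\<exists>lp. \<forall>w\<in>F. \<exists>cs. runs lp w (enc_system cs) \<and>
            describes (enum w) cs (payoffs (game w) (players (game w))))"

definition core_producing ::
    "prog \<Rightarrow> data set \<Rightarrow> (data \<Rightarrow> 'a game) \<Rightarrow> (data \<Rightarrow> 'a list) \<Rightarrow> bool" where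
  "core_producing A F game enum \<longleftrightarrow>
     (\<forall>w\<in>F. \<exists>\<pi> \<in> core (game w). runs A w (enc_payoff (enum w) \<pi>))"

end

theory Submission
  imports Defs
begin

text \<open>
  Mix a core vector \<open>c\<close> with a fairest vector: \<open>(1 - \<lambda>) c + \<lambda> f\<close> lies in the polytope by convexity,
  dominates \<open>(1 - \<lambda>) c\<close>, and has fairness at least \<open>\<lambda>\<close> times that of \<open>f\<close>.  No general linear
  programming is needed to find \<open>f\<close>: by downward closure a fairest vector can be chosen constant
  on the players, and the largest feasible constant is the minimum of \<open>b / (\<Sum>j. a\<^sub>j)\<close>
  over the inequalities \<open>a \<bullet> x \<le> b\<close> with positive coefficient sum.
\<close>

subsection \<open>Programs on lists\<close>

lemma runs_IsCell_Cell: "runs IsCell (Cell x y) (Num 1)"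
  using runs.intros(13)[of "Cell x y"] by simp

lemma runs_IsCell_Null: "runs IsCell Null (Num 0)"
  using runs.intros(13)[of Null] by simp

text \<open>The loop memory is a pair of remaining list and accumulator; \<open>p\<close> turns the
  pair of list head and accumulator into the next accumulator.\<close>

definition fold_prog :: "prog \<Rightarrow> prog" where
  "fold_prog p =
     Seq (Loop (Seq Left IsCell) (Fork (Seq Left Right) (Seq (Fork (Seq Left Left) Right) p))) Right"

text \<open>Separate encodings \<open>e\<close> of elements and \<open>g\<close> of states let one
  induction serve numbers, lists and pairs as accumulators, including states that carry read-only
  data.\<close>

lemma runs_fold_prog:
  assumes "\<And>x s. runs p (Cell (e x) (g s)) (g (f x s))"
  shows "runs (fold_prog p) (Cell (enc_list (map e xs)) (g s)) (g (fold f xs s))"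
proof -
  let ?loop = "Loop (Seq Left IsCell) (Fork (Seq Left Right) (Seq (Fork (Seq Left Left) Right) p))"
  have "runs ?loop (Cell (enc_list (map e xs)) (g s)) (Cell Null (g (fold f xs s)))"
  proof (induction xs arbitrary: s)
    case Nil
    have "runs (Seq Left IsCell) (Cell Null (g s)) (Num 0)"
      by (rule runs.intros runs_IsCell_Null)+
    from runs.intros(17)[OF this] show ?case by simp
  next
    case (Cons x xs)
    let ?l = "Cell (Cell (e x) (enc_list (map e xs))) (g s)"
    have "runs (Seq Left IsCell) ?l (Num 1)"
      by (rule runs.intros(4,7) runs_IsCell_Cell)+
    moreover have "runs (Fork (Seq Left Right) (Seq (Fork (Seq Left Left) Right) p)) ?l
        (Cell (enc_list (map e xs)) (g (f x s)))"
      by (rule runs.intros(4-7) assms)+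
    ultimately show ?case
      using Cons.IH[of "f x s"] runs.intros(16) by fastforce
  qed
  then show ?thesis
    unfolding fold_prog_def by (rule runs.intros(7)) (rule runs.intros)
qed

definition zero_prog :: prog where
  "zero_prog = Seq (Fork Unit Unit) Sub"

lemma runs_zero_prog: "runs zero_prog x (Num 0)"
proof -
  have "runs zero_prog x (Num (1 - 1))"
    unfolding zero_prog_def by (rule runs.intros)+
  then show ?thesis by simp
qed

definition sum_prog :: prog where
  "sum_prog = Seq (Fork Ident zero_prog) (fold_prog Add)"

lemma runs_sum_prog: "runs sum_prog (enc_vec xs) (Num (sum_list xs))"
proof -
  have "runs (fold_prog Add) (Cell (enc_vec xs) (Num 0)) (Num (fold (+) xs 0))"
    unfolding enc_vec_def by (rule runs_fold_prog) (rule runs.intros)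
  then have fold: "runs (fold_prog Add) (Cell (enc_vec xs) (Num 0)) (Num (sum_list xs))"
    by (simp add: fold_plus_sum_list_rev)
  show ?thesis
    unfolding sum_prog_def by (rule runs.intros(1,6,7) runs_zero_prog fold)+
qed

text \<open>The step is \<open>Ident\<close> because the pair of head and accumulator is already the
  accumulator with the head put in front.\<close>

definition rev_prog :: prog where
  "rev_prog = Seq (Fork Ident Empty) (fold_prog Ident)"

lemma runs_rev_prog: "runs rev_prog (enc_list xs) (enc_list (rev xs))"
proof -
  have "runs (fold_prog Ident) (Cell (enc_list (map id xs)) (enc_list [])) (enc_list (fold (#) xs []))"
    by (rule runs_fold_prog) (simp add: runs.intros(1))
  then have fold: "runs (fold_prog Ident) (Cell (enc_list xs) Null) (enc_list (rev xs))"
    by (simp add: rev_conv_fold)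
  show ?thesis
    unfolding rev_prog_def by (rule runs.intros(1,2,6,7) fold)+
qed

text \<open>A step sees only the head and the accumulator, so the two scalars travel inside the
  accumulator, unchanged. The results pile up in reverse order, which \<open>affine_prog\<close>
  undoes.\<close>

definition affine_step :: prog where
  "affine_step =
     Fork (Seq Right Left)
       (Fork (Seq (Fork (Seq (Fork (Seq Right (Seq Left Left)) Left) Mul) (Seq Right (Seq Left Right))) Add)
         (Seq Right Right))"

definition affine_prog :: prog where
  "affine_prog =
     Seq (Seq (Fork Left (Fork Right Empty)) (fold_prog affine_step)) (Seq Right rev_prog)"

lemma runs_affine_prog:
  "runs affine_prog (Cell (enc_vec xs) (Cell (Num v) (Num u))) (enc_vec (map (\<lambda>x. v * x + u) xs))"
proof -
  let ?g = "\<lambda>ys. Cell (Cell (Num v) (Num u)) (enc_vec ys)"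
  let ?f = "\<lambda>x ys. (v * x + u) # ys"
  have "runs affine_step (Cell (Num x) (?g ys)) (?g (?f x ys))" for x ys
    unfolding affine_step_def enc_vec_def list.map enc_list.simps
    by (rule runs.intros)+
  then have "runs (fold_prog affine_step) (Cell (enc_list (map Num xs)) (?g [])) (?g (fold ?f xs []))"
    by (rule runs_fold_prog)
  moreover have "fold ?f xs ys = rev (map (\<lambda>x. v * x + u) xs) @ ys" for ys
    by (induction xs arbitrary: ys) auto
  ultimately have "runs (fold_prog affine_step) (Cell (enc_vec xs) (Cell (Cell (Num v) (Num u)) Null))
      (?g (rev (map (\<lambda>x. v * x + u) xs)))"
    by (simp add: enc_vec_def)
  moreover have "runs rev_prog (enc_vec (rev (map (\<lambda>x. v * x + u) xs))) (enc_vec (map (\<lambda>x. v * x + u) xs))"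
    using runs_rev_prog[of "map Num (rev (map (\<lambda>x. v * x + u) xs))"]
    by (simp add: enc_vec_def rev_map)
  ultimately show ?thesis
    unfolding affine_prog_def by (meson runs.intros(2,4-7))
qed

subsection \<open>The largest feasible constant\<close>

text \<open>
  A pair \<open>(p, q)\<close> stands for the bound \<open>t q \<le> p\<close> on \<open>t \<ge> 0\<close>, so that \<open>(1, 0)\<close> means no bound.
  Cross-multiplication compares bounds without division, and it never selects an
  inequality whose coefficient sum is not positive.
\<close>

fun tighten :: "real list \<times> real \<Rightarrow> real \<times> real \<Rightarrow> real \<times> real" where
  "tighten (a, b) (p, q) = (if p * sum_list a - b * q > 0 then (b, sum_list a) else (p, q))"

definition pick_prog :: prog where
  "pick_prog =
     Branch
       (Seq (Fork (Seq (Fork (Seq Right Left) (Seq Left Right)) Mul)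
                  (Seq (Fork (Seq Left Left) (Seq Right Right)) Mul)) Sub)
       Left Right"

definition tighten_prog :: prog where
  "tighten_prog =
     Seq (Fork (Fork (Seq Left Right) (Seq Left (Seq Left sum_prog))) Right) pick_prog"

lemma runs_pick_prog:
  "runs pick_prog (Cell (Cell (Num b) (Num s)) (Cell (Num p) (Num q)))
     (if p * s - b * q > 0 then Cell (Num b) (Num s) else Cell (Num p) (Num q))"
    (is "runs _ ?x _")
proof -
  have cond: "runs (Seq (Fork (Seq (Fork (Seq Right Left) (Seq Left Right)) Mul)
      (Seq (Fork (Seq Left Left) (Seq Right Right)) Mul)) Sub) ?x (Num (p * s - b * q))"
    by (rule runs.intros)+
  show ?thesis
  proof (cases "p * s - b * q > 0")
    case True
    from runs.intros(14)[OF cond True runs.intros(4)] True show ?thesis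
      unfolding pick_prog_def by simp
  next
    case False
    then have "p * s - b * q \<le> 0" by simp
    from runs.intros(15)[OF cond this runs.intros(5)] False show ?thesis
      unfolding pick_prog_def by simp
  qed
qed

lemma runs_tighten_prog:
  "runs tighten_prog (Cell (Cell (enc_vec a) (Num b)) (Cell (Num p) (Num q)))
     (if p * sum_list a - b * q > 0 then Cell (Num b) (Num (sum_list a)) else Cell (Num p) (Num q))"
  unfolding tighten_prog_def by (rule runs.intros(4-7) runs_sum_prog runs_pick_prog)+

definition bound_prog :: prog where
  "bound_prog = Seq (Fork Ident (Fork Unit zero_prog)) (fold_prog tighten_prog)"

lemma runs_bound_prog:
  assumes "fold tighten cs (1, 0) = (p, q)"
  shows "runs bound_prog (enc_system cs) (Cell (Num p) (Num q))"
proof -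
  let ?e = "\<lambda>(a, b). Cell (enc_vec a) (Num b)"
  let ?g = "\<lambda>(p, q). Cell (Num p) (Num q)"
  have "runs tighten_prog (Cell (?e x) (?g s)) (?g (tighten x s))" for x s
    using runs_tighten_prog by (cases x; cases s) (simp add: if_distrib)
  then have "runs (fold_prog tighten_prog) (Cell (enc_list (map ?e cs)) (?g (1, 0)))
      (?g (fold tighten cs (1, 0)))"
    by (rule runs_fold_prog)
  then have fold: "runs (fold_prog tighten_prog) (Cell (enc_system cs) (Cell (Num 1) (Num 0)))
      (Cell (Num p) (Num q))"
    by (simp add: assms enc_system_def)
  show ?thesis
    unfolding bound_prog_def by (rule runs.intros(1,3,6,7) runs_zero_prog fold)+
qed

text \<open>A successful test means that the new quotient is strictly smaller, so the new bound
  implies the old one; after a failed test the old bound implies the new inequality. The pair (0, 0)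
  must be excluded: it imposes no bound, yet the test could never replace it.\<close>

lemma tighten_bound:
  assumes "0 \<le> b" "0 \<le> p" "0 \<le> q" "0 < p \<or> 0 < q" "tighten (a, b) (p, q) = (p', q')"
  shows "0 \<le> p'" "0 \<le> q'" "0 < p' \<or> 0 < q'"
    and "0 \<le> t \<Longrightarrow> t * q' \<le> p' \<longleftrightarrow> t * q \<le> p \<and> t * sum_list a \<le> b"
proof -
  define s where "s = sum_list a"
  have *: "0 \<le> p' \<and> 0 \<le> q' \<and> (0 < p' \<or> 0 < q') \<and>
    (0 \<le> t \<longrightarrow> (t * q' \<le> p' \<longleftrightarrow> t * q \<le> p \<and> t * s \<le> b))"
  proof (cases "p * s - b * q > 0")
    case True
    then have "p * s > 0"
      using mult_nonneg_nonneg[OF assms(1,3)] by linarith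
    then have s: "s > 0"
      using assms(2) by (simp add: zero_less_mult_iff)
    have "t * q \<le> p" if "t * s \<le> b"
    proof -
      have "(t * q) * s \<le> b * q"
        using mult_right_mono[OF that assms(3)] by (simp add: ac_simps)
      also have "\<dots> \<le> p * s" using True by simp
      finally show ?thesis using s by simp
    qed
    with True s assms show ?thesis by (auto simp: s_def)
  next
    case False
    \<comment> \<open>For \<open>s > 0\<close> the failed test compares the two quotients; otherwise
      \<open>t * s \<le> 0 \<le> b\<close>.\<close>
    have "t * s \<le> b" if t: "0 \<le> t" "t * q \<le> p"
    proof (cases "s > 0")
      case s: True
      \<comment> \<open>With \<open>q = 0\<close> the invariant gives \<open>p > 0\<close>, and then
        \<open>p * s > 0\<close> would make the test succeed.\<close>
      then have "q \<noteq> 0"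
        using False assms(4) mult_pos_pos[of p s] by auto
      then have q: "q > 0" using assms(3) by simp
      have "(t * s) * q \<le> p * s"
        using mult_right_mono[OF t(2), of s] s by (simp add: ac_simps)
      also have "\<dots> \<le> b * q" using False by simp
      finally show ?thesis using q by simp
    next
      case False
      then show ?thesis
        using t(1) assms(1) mult_nonneg_nonpos[of t s] by linarith
    qed
    with False assms show ?thesis by (auto simp: s_def)
  qed
  show "0 \<le> p'" "0 \<le> q'" "0 < p' \<or> 0 < q'"
    and "0 \<le> t \<Longrightarrow> t * q' \<le> p' \<longleftrightarrow> t * q \<le> p \<and> t * sum_list a \<le> b"
    using * by (simp_all add: s_def)
qed

lemma fold_tighten_bound:
  assumes "\<forall>(a, b)\<in>set cs. 0 \<le> b" "0 \<le> p" "0 \<le> q" "0 < p \<or> 0 < q"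
    and "fold tighten cs (p, q) = (p', q')"
  shows "0 \<le> p' \<and> 0 \<le> q' \<and>
    (\<forall>t\<ge>0. t * q' \<le> p' \<longleftrightarrow> t * q \<le> p \<and> (\<forall>(a, b)\<in>set cs. t * sum_list a \<le> b))"
  using assms
proof (induction cs arbitrary: p q)
  case Nil
  then show ?case by simp
next
  case (Cons c cs)
  obtain a b where c: "c = (a, b)" by (cases c)
  obtain p1 q1 where pq: "tighten (a, b) (p, q) = (p1, q1)" by (cases "tighten (a, b) (p, q)")
  have "0 \<le> b" using Cons.prems(1) by (simp add: c)
  note bound = tighten_bound[OF this Cons.prems(2-4) pq]
  have "fold tighten cs (p1, q1) = (p', q')"
    using Cons.prems(5) unfolding c fold_simps pq .
  moreover have "\<forall>(a, b)\<in>set cs. 0 \<le> b" using Cons.prems(1) by simp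
  ultimately show ?case
    using Cons.IH[of p1 q1] bound by (auto simp: c)
qed

text \<open>A half-space is convex, so a bound on the finitely many generating points passes to
  their hull, without any topology on the function space.\<close>

lemma polytope_fun_bounded_above:
  fixes P :: "('a \<Rightarrow> real) set"
  assumes "polytope P"
  shows "\<exists>M. \<forall>\<pi>\<in>P. \<pi> i \<le> M"
proof -
  obtain V where V: "finite V" "P = convex hull V"
    using assms unfolding polytope_def by blast
  \<comment> \<open>Inserting 0 keeps the maximum well defined when \<open>V\<close> is
    empty.\<close>
  define M where "M = Max (insert 0 ((\<lambda>\<pi>. \<pi> i) ` V))"
  have "P \<subseteq> {\<pi>. \<pi> i \<le> M}"
    unfolding V(2)
  proof (rule hull_minimal)
    show "V \<subseteq> {\<pi>. \<pi> i \<le> M}"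
      using V(1) by (auto simp: M_def)
    show "convex {\<pi>. \<pi> i \<le> M}"
      unfolding convex_def by (auto simp: scaleR_fun_def intro: convex_bound_le)
  qed
  then show ?thesis by blast
qed

text \<open>On a vector with constant value \<open>t\<close> on the players, each inequality reads
  \<open>t * sum_list a \<le> b\<close>, so the folded pair collects exactly the feasible constants.
  Boundedness of \<open>P\<close> yields \<open>0 < q\<close>, which makes the final division
  legal.\<close>

lemma largest_constant:
  assumes ps: "ps \<noteq> []" and cs: "describes ps cs P"
    and P: "polytope P" "(\<lambda>_. 0) \<in> P"
    and pq: "fold tighten cs (1, 0) = (p, q)"
  shows "0 \<le> p" "0 < q"
    and "0 \<le> t \<Longrightarrow> (\<lambda>i. if i \<in> set ps then t else 0) \<in> P \<longleftrightarrow> t \<le> p / q"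
proof -
  \<comment> \<open>The inequalities are evaluated at the zero vector.\<close>
  have "\<forall>(a, b)\<in>set cs. 0 \<le> b"
    using cs P(2) by (auto simp: describes_def)
  from fold_tighten_bound[OF this _ _ _ pq]
  have bound: "0 \<le> p" "0 \<le> q"
      "\<And>t. 0 \<le> t \<Longrightarrow> t * q \<le> p \<longleftrightarrow> (\<forall>(a, b)\<in>set cs. t * sum_list a \<le> b)"
    by auto
  have eq: "(\<lambda>i. if i \<in> set ps then t else 0) \<in> P \<longleftrightarrow> t * q \<le> p" if "0 \<le> t" for t
  proof -
    have "(\<Sum>j<length ps. a ! j * (if ps ! j \<in> set ps then t else 0)) = t * sum_list a"
      if "(a, b) \<in> set cs" for a b
    proof -
      have "length a = length ps" using cs that by (auto simp: describes_def)
      then show ?thesis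
        by (simp add: sum_list_sum_nth atLeast0LessThan sum_distrib_left mult.commute)
    qed
    then show ?thesis
      using cs unfolding bound(3)[OF that] by (fastforce simp: describes_def)
  qed
  obtain i where i: "i \<in> set ps" using ps by (cases ps) auto
  obtain M where M: "\<And>\<pi>. \<pi> \<in> P \<Longrightarrow> \<pi> i \<le> M"
    using polytope_fun_bounded_above[OF P(1)] by meson
  have "q \<noteq> 0"
  proof
    \<comment> \<open>Then every nonnegative constant is feasible; \<bar>M\<bar> + 1 is one that
      exceeds the bound \<open>M\<close> on coordinate \<open>i\<close>.\<close>
    assume "q = 0"
    then have "(\<lambda>i. if i \<in> set ps then \<bar>M\<bar> + 1 else 0) \<in> P"
      using eq[of "\<bar>M\<bar> + 1"] bound(1) by simp
    from M[OF this] i show False by simp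
  qed
  with bound(1,2) show "0 \<le> p" "0 < q" by simp_all
  then show "(\<lambda>i. if i \<in> set ps then t else 0) \<in> P \<longleftrightarrow> t \<le> p / q" if "0 \<le> t"
    using eq[OF that] by (simp add: pos_le_divide_eq)
qed

subsection \<open>Mixing a core vector with a constant\<close>

text \<open>Lowering every player's payoff to the minimum stays feasible by downward closure, so the
  fairness of each payoff vector is itself a feasible constant.\<close>

lemma LP_fair_le_constant:
  assumes G: "downwards_closed_game G" and ne: "payoffs G (players G) \<noteq> {}"
    and T: "\<And>t. 0 \<le> t \<Longrightarrow> (\<lambda>i. if i \<in> players G then t else 0) \<in> payoffs G (players G) \<Longrightarrow> t \<le> T"
  shows "LP_fair G \<le> T"
  unfolding LP_fair_def
proof (rule cSUP_least[OF ne])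
  fix \<pi> assume \<pi>: "\<pi> \<in> payoffs G (players G)"
  have fin: "finite (players G)" "players G \<noteq> {}"
    and nonneg: "\<And>i. 0 \<le> \<pi> i"
    and down: "\<And>\<pi>'. (\<forall>i. 0 \<le> \<pi>' i \<and> \<pi>' i \<le> \<pi> i) \<Longrightarrow> \<pi>' \<in> payoffs G (players G)"
    using G \<pi> unfolding downwards_closed_game_def by blast+
  have "0 \<le> fairness G \<pi>"
    using fin nonneg by (auto simp: fairness_def)
  moreover have "fairness G \<pi> \<le> \<pi> i" if "i \<in> players G" for i
    using fin that by (auto simp: fairness_def)
  ultimately show "fairness G \<pi> \<le> T"
    using nonneg by (intro T down) auto
qed

text \<open>A coalition that beats \<pi> by the factor \<open>1 / (1 - lam)\<close> gives each
  member more than \<open>c\<close> does, since \<pi> is at least \<open>(1 - lam) * c\<close> on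
  the players; it would therefore block \<open>c\<close>.\<close>

lemma mixture_approx_core:
  assumes G: "downwards_closed_game G" and c: "c \<in> core G"
    and T: "0 \<le> T" "(\<lambda>i. if i \<in> players G then T else 0) \<in> payoffs G (players G)"
    and lam: "0 < lam" "lam < 1"
    and \<pi>: "\<pi> = (\<lambda>i. if i \<in> players G then (1 - lam) * c i + lam * T else 0)"
  shows "\<pi> \<in> approx_core (1 / (1 - lam)) G" and "lam * T \<le> fairness G \<pi>"
proof -
  have fin: "finite (players G)" "players G \<noteq> {}"
    and conv: "convex (payoffs G (players G))"
    using G polytope_imp_convex unfolding downwards_closed_game_def by blast+
  have c_in: "c \<in> payoffs G (players G)"
    using c by (simp add: core_def approx_core_def)
  then have c_props: "0 \<le> c i" "i \<notin> players G \<Longrightarrow> c i = 0" for i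
    using G unfolding downwards_closed_game_def by blast+
  have "\<pi> = (1 - lam) *\<^sub>R c + lam *\<^sub>R (\<lambda>i. if i \<in> players G then T else 0)"
    by (auto simp: \<pi> scaleR_fun_def fun_eq_iff c_props)
  then have \<pi>_in: "\<pi> \<in> payoffs G (players G)"
    using convexD[OF conv c_in T(2), of "1 - lam" lam] lam by simp
  have dom: "c i \<le> 1 / (1 - lam) * \<pi> i" if "i \<in> players G" for i
    using that lam T(1) by (simp add: \<pi> field_simps)
  have "\<not> (\<exists>S \<pi>'. S \<noteq> {} \<and> S \<subset> players G \<and> \<pi>' \<in> payoffs G S \<and>
      (\<forall>i\<in>S. \<pi>' i > 1 / (1 - lam) * \<pi> i))"
  proof (rule notI, elim exE conjE)
    fix S \<pi>' assume S: "S \<noteq> {}" "S \<subset> players G" "\<pi>' \<in> payoffs G S"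
      and gt: "\<forall>i\<in>S. \<pi>' i > 1 / (1 - lam) * \<pi> i"
    have "\<forall>i\<in>S. \<pi>' i > 1 * c i"
      using gt dom S(2) by (metis mult_1 order.strict_trans1 psubsetD)
    with c S show False unfolding core_def approx_core_def by blast
  qed
  with \<pi>_in show "\<pi> \<in> approx_core (1 / (1 - lam)) G"
    by (simp add: approx_core_def)
  show "lam * T \<le> fairness G \<pi>"
    using fin lam c_props(1) by (auto simp: fairness_def \<pi>)
qed

text \<open>The input is the pair of \<open>lam\<close> and the instance. The first component
  prepares the core vector, the second the slope \<open>1 - lam\<close> and the offset
  \<open>lam * (p / q)\<close> for \<open>affine_prog\<close>.\<close>

definition mix_prog :: "prog \<Rightarrow> prog \<Rightarrow> prog" where
  "mix_prog A lp =
     Seq (Fork (Seq Right A)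
           (Fork (Seq (Fork Unit Left) Sub)
             (Seq (Fork Left (Seq (Seq (Seq Right lp) bound_prog) Div)) Mul)))
       affine_prog"

lemma runs_mix_prog:
  assumes "runs A w (enc_vec xs)" "runs lp w (enc_system cs)"
    and "fold tighten cs (1, 0) = (p, q)" "q \<noteq> 0"
  shows "runs (mix_prog A lp) (Cell (Num lam) w)
    (enc_vec (map (\<lambda>x. (1 - lam) * x + lam * (p / q)) xs))"
  unfolding mix_prog_def
  by (rule runs.intros(3-7,9-11) runs_affine_prog assms(1,2,4) runs_bound_prog[OF assms(3)])+

theorem theorem3:
  fixes F :: "data set" and game :: "data \<Rightarrow> 'a game" and enum :: "data \<Rightarrow> 'a list" and A :: prog
  assumes "downwards_closed_family F game enum"
    and "core_producing A F game enum"
  shows "\<exists>B. \<forall>w\<in>F. \<forall>\<tau> lam. 0 \<le> \<tau> \<longrightarrow> LP_fair (game w) \<ge> \<tau> \<longrightarrow> 0 < lam \<longrightarrow> lam < 1 \<longrightarrow>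
           (\<exists>\<pi> \<in> approx_core (1 / (1 - lam)) (game w).
              fairness (game w) \<pi> \<ge> lam * \<tau> \<and>
              runs B (Cell (Num lam) w) (enc_payoff (enum w) \<pi>))"
proof -
  obtain lp where lp: "\<And>w. w \<in> F \<Longrightarrow> \<exists>cs. runs lp w (enc_system cs) \<and>
      describes (enum w) cs (payoffs (game w) (players (game w)))"
    using assms(1) unfolding downwards_closed_family_def by blast
  show ?thesis
  \<comment> \<open>One program serves all \<tau>: it does not read \<tau> but computes the largest
    feasible constant, which bounds \<open>LP_fair\<close> and hence every admissible
    \<tau>.\<close>
  proof (intro exI[of _ "mix_prog A lp"] ballI allI impI)
    fix w \<tau> lam
    assume w: "w \<in> F" and \<tau>: "\<tau> \<le> LP_fair (game w)" and lam: "0 < lam" "lam < (1::real)"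
    let ?G = "game w" and ?ps = "enum w"
    let ?P = "payoffs ?G (players ?G)"
    have G: "downwards_closed_game ?G" and ps: "set ?ps = players ?G"
      using assms(1) w unfolding downwards_closed_family_def by blast+
    obtain cs where cs: "runs lp w (enc_system cs)" "describes ?ps cs ?P"
      using lp[OF w] by blast
    obtain c where c: "c \<in> core ?G" "runs A w (enc_payoff ?ps c)"
      using assms(2) w unfolding core_producing_def by blast
    have c_in: "c \<in> ?P" using c(1) by (simp add: core_def approx_core_def)
    have "?ps \<noteq> []" "polytope ?P" "(\<lambda>_. 0) \<in> ?P"
      using G ps c_in unfolding downwards_closed_game_def by fastforce+
    moreover obtain p q where pq: "fold tighten cs (1, 0) = (p, q)"
      by (cases "fold tighten cs (1, 0)")
    ultimately have p: "0 \<le> p" and q: "0 < q"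
      and const: "\<And>t. 0 \<le> t \<Longrightarrow>
        (\<lambda>i. if i \<in> players ?G then t else 0) \<in> ?P \<longleftrightarrow> t \<le> p / q"
      using largest_constant[OF _ cs(2)] unfolding ps by blast+
    define \<pi> where "\<pi> = (\<lambda>i. if i \<in> players ?G then (1 - lam) * c i + lam * (p / q) else 0)"
    have T: "0 \<le> p / q" using p q by simp
    note mix = mixture_approx_core[OF G c(1) T _ lam \<pi>_def]
    have "LP_fair ?G \<le> p / q"
      using LP_fair_le_constant[OF G] c_in const by blast
    then have "lam * \<tau> \<le> lam * (p / q)"
      using \<tau> lam by (intro mult_left_mono) auto
    then have "lam * \<tau> \<le> fairness ?G \<pi>"
      using mix(2) const[OF T] by simp
    moreover have "\<pi> \<in> approx_core (1 / (1 - lam)) ?G"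
      using mix(1) const[OF T] by simp
    moreover have "runs (mix_prog A lp) (Cell (Num lam) w) (enc_payoff ?ps \<pi>)"
    proof -
      \<comment> \<open>The enumeration lists only players, so the default value 0 in \<pi> never
        appears in the output.\<close>
      have "map \<pi> ?ps = map (\<lambda>x. (1 - lam) * x + lam * (p / q)) (map c ?ps)"
        using ps by (simp add: \<pi>_def)
      moreover have "q \<noteq> 0" using q by simp
      ultimately show ?thesis
        using runs_mix_prog[OF c(2)[unfolded enc_payoff_def] cs(1) pq]
        unfolding enc_payoff_def by metis
    qed
    ultimately show "\<exists>\<pi>\<in>approx_core (1 / (1 - lam)) ?G. lam * \<tau> \<le> fairness ?G \<pi> \<and>
        runs (mix_prog A lp) (Cell (Num lam) w) (enc_payoff ?ps \<pi>)"
      by blast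
  qed
qed

end
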